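(* If $G$ is a caterpillar with maximum degree $\Delta$, then $\Delta+1\leq \chi_{td}(G)\leq \Delta+3$.
   Context: Graphs are finite, simple and undirected. A caterpillar is a tree in which all vertices are at distance at most 1 from a central path; equivalently, a tree such that removing its vertices of degree one and their incident edges leaves a path. A total labeling of a graph $G$ is a function $f:V(G)\cup E(G)\to\mathbb{Z}^+$ (positive integers) such that $f(u)\neq f(v)$ for adjacent vertices $u,v$; $f(\{u,v\})\neq f(\{v,w\})$ for any two distinct incident edges $\{u,v\},\{v,w\}$; and $f(u)\neq f(\{u,v\})$ for every edge $\{u,v\}$ and incident vertex $u$. It is a $k$-total labeling if the maximum label assigned to any vertex or edge is $k$. A $k$-total difference labeling is a $k$-total labeling $f$ with $f(\{u,v\})=|f(u)-f(v)|$ for every edge $\{u,v\}$. The total difference chromatic number $\chi_{td}(G)$ is the smallest integer $k$ for which $G$ has a $k$-total difference labeling. *)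

theory Defs
  imports "Graph_Theory.Graph_Theory"
begin

text \<open>
  A finite simple undirected graph is a value satisfying \<open>pair_graph\<close>: a finite, symmetric and
  loop-free digraph without parallel arcs. The undirected edge between \<open>u\<close> and \<open>v\<close> is the
  two-element set underlying the arcs \<open>(u, v)\<close> and \<open>(v, u)\<close>.
\<close>

definition edges :: "'a pair_pre_digraph \<Rightarrow> 'a set set" where
  "edges G = {{u, v} | u v. (u, v) \<in> parcs G}"

text \<open>By symmetry, the out-degree counts each incident undirected edge exactly once.\<close>

definition max_degree :: "'a pair_pre_digraph \<Rightarrow> nat" where
  "max_degree G = Max (out_degree (with_proj G) ` pverts G)"

text \<open>
  The library's \<open>tree\<close> forbids all directed cycles, hence every symmetric digraph with an edge
  (\<open>u\<close>, \<open>v\<close>, \<open>u\<close> is a directed cycle). The cycles of the undirected graph are exactly the directed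
  cycles of length at least three.
\<close>

definition undirected_tree :: "'a pair_pre_digraph \<Rightarrow> bool" where
  "undirected_tree G \<longleftrightarrow> pair_graph G \<and> connected (with_proj G) \<and>
     \<not> (\<exists>c. pre_digraph.cycle (with_proj G) c \<and> length c \<ge> 3)"

text \<open>\<open>wf_digraph.\<mu>\<close> is the shortest-path cost; with unit arc costs it is the graph distance.\<close>

definition distance :: "'a pair_pre_digraph \<Rightarrow> 'a \<Rightarrow> 'a \<Rightarrow> ereal" where
  "distance G u v = wf_digraph.\<mu> (with_proj G) (\<lambda>_. 1) u v"

text \<open>The central path may consist of a single vertex, so stars are caterpillars.\<close>

definition caterpillar :: "'a pair_pre_digraph \<Rightarrow> bool" where
  "caterpillar G \<longleftrightarrow> undirected_tree G \<and>
     (\<exists>p. vpath p (with_proj G) \<and> (\<forall>v \<in> pverts G. \<exists>u \<in> set p. distance G u v \<le> 1))"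

text \<open>
  A labeling of \<open>V(G) \<union> E(G)\<close> is a function on a sum type, \<open>Inl v\<close> standing for a vertex and
  \<open>Inr {u, v}\<close> for an edge; its values outside \<open>elements G\<close> are irrelevant.
\<close>

definition elements :: "'a pair_pre_digraph \<Rightarrow> ('a + 'a set) set" where
  "elements G = pverts G <+> edges G"

definition total_labeling :: "'a pair_pre_digraph \<Rightarrow> ('a + 'a set \<Rightarrow> nat) \<Rightarrow> bool" where
  "total_labeling G f \<longleftrightarrow>
     (\<forall>x \<in> elements G. f x > 0) \<and>
     (\<forall>u v. {u, v} \<in> edges G \<longrightarrow> f (Inl u) \<noteq> f (Inl v)) \<and>
     (\<forall>u v w. {u, v} \<in> edges G \<and> {v, w} \<in> edges G \<and> {u, v} \<noteq> {v, w} \<longrightarrow>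
        f (Inr {u, v}) \<noteq> f (Inr {v, w})) \<and>
     (\<forall>u v. {u, v} \<in> edges G \<longrightarrow> f (Inl u) \<noteq> f (Inr {u, v}))"

definition k_total_labeling ::
  "'a pair_pre_digraph \<Rightarrow> nat \<Rightarrow> ('a + 'a set \<Rightarrow> nat) \<Rightarrow> bool" where
  "k_total_labeling G k f \<longleftrightarrow> total_labeling G f \<and> Max (f ` elements G) = k"

definition k_total_difference_labeling ::
  "'a pair_pre_digraph \<Rightarrow> nat \<Rightarrow> ('a + 'a set \<Rightarrow> nat) \<Rightarrow> bool" where
  "k_total_difference_labeling G k f \<longleftrightarrow> k_total_labeling G k f \<and>
     (\<forall>u v. {u, v} \<in> edges G \<longrightarrow>
        int (f (Inr {u, v})) = \<bar>int (f (Inl u)) - int (f (Inl v))\<bar>)"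

definition chi_td :: "'a pair_pre_digraph \<Rightarrow> nat" where
  "chi_td G = (LEAST k. \<exists>f. k_total_difference_labeling G k f)"

text \<open>The minimum in \<open>chi_td\<close> is over a nonempty set: label the vertices by distinct powers of 3.\<close>

lemma ex_total_difference_labeling:
  assumes "pair_graph G"
  shows "\<exists>k f. k_total_difference_labeling G k f"
proof -
  interpret pair_graph G by fact
  obtain h :: "'a \<Rightarrow> nat" where h: "inj_on h (pverts G)"
    using finite_imp_inj_to_nat_seg[OF pair_finite_verts] by auto
  define g :: "'a \<Rightarrow> int" where "g v = 3 ^ h v" for v
  define f :: "'a + 'a set \<Rightarrow> nat" where
    "f x = nat (case x of Inl v \<Rightarrow> g v | Inr e \<Rightarrow> Max (g ` e) - Min (g ` e))" for x
  have fV: "int (f (Inl v)) = g v" for v by (simp add: f_def g_def)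
  have fE: "int (f (Inr {u, v})) = \<bar>g u - g v\<bar>" for u v
  proof -
    have "Max (g ` {u, v}) - Min (g ` {u, v}) = \<bar>g u - g v\<bar>" by simp
    then show ?thesis by (simp only: f_def sum.case)
  qed
  have E: "u \<in> pverts G \<and> v \<in> pverts G \<and> u \<noteq> v" if "{u, v} \<in> edges G" for u v
  proof -
    obtain a b where ab: "{u, v} = {a, b}" "(a, b) \<in> parcs G"
      using \<open>{u, v} \<in> edges G\<close> unfolding edges_def by blast
    then show ?thesis using pair_no_loops[OF ab(2)] wellformed'[OF ab(2)]
      by (auto simp: doubleton_eq_iff)
  qed
  have pow: "(3::int) ^ b \<ge> 3 * 3 ^ a" if "a < b" for a b
    using power_increasing[of "Suc a" b "3::int"] that by simp
  have gpos: "g v > 0" for v by (simp add: g_def)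
  have gap: "3 * g u \<le> g v \<or> 3 * g v \<le> g u"
    if "u \<in> pverts G" "v \<in> pverts G" "u \<noteq> v" for u v
    using inj_onD[OF h _ that(1,2)] that(3) pow[of "h u" "h v"] pow[of "h v" "h u"]
    unfolding g_def by (meson linorder_neqE_nat)
  have "f x > 0" if "x \<in> elements G" for x
  proof -
    have "int (f x) > 0"
    proof (cases x)
      case (Inl v) then show ?thesis using fV gpos by simp
    next
      case (Inr e)
      then have "e \<in> edges G" using that by (auto simp: elements_def)
      moreover from this obtain u v where "e = {u, v}" unfolding edges_def by blast
      ultimately have e: "e = {u, v}" "{u, v} \<in> edges G" by simp_all
      then show ?thesis using fE[of u v] gap[of u v] E[OF e(2)] gpos[of u] gpos[of v] Inr by (smt (verit))
    qed
    then show ?thesis by simp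
  qed
  moreover have "f (Inl u) \<noteq> f (Inl v)" if "{u, v} \<in> edges G" for u v
    using gap[of u v] E[OF that] gpos[of u] gpos[of v] fV[of u] fV[of v] by (smt (verit))
  moreover have "f (Inl u) \<noteq> f (Inr {u, v})" if "{u, v} \<in> edges G" for u v
  proof -
    have "g u \<noteq> \<bar>g u - g v\<bar>" using gap[of u v] E[OF that] gpos[of u] gpos[of v] by (smt (verit))
    then show ?thesis using fV[of u] fE[of u v] by auto
  qed
  moreover have "f (Inr {u, v}) \<noteq> f (Inr {v, w})"
    if "{u, v} \<in> edges G" "{v, w} \<in> edges G" "{u, v} \<noteq> {v, w}" for u v w
  proof -
    have "u \<noteq> w" using that(3) by (auto simp: insert_commute)
    then have "\<bar>g u - g v\<bar> \<noteq> \<bar>g v - g w\<bar>"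
      using gap[of u v] gap[of v w] gap[of u w] E[OF that(1)] E[OF that(2)]
        gpos[of u] gpos[of v] gpos[of w] by (smt (verit))
    then show ?thesis using fE[of u v] fE[of v w] by auto
  qed
  ultimately have "total_labeling G f" unfolding total_labeling_def by blast
  then have "k_total_difference_labeling G (Max (f ` elements G)) f"
    by (simp add: k_total_difference_labeling_def k_total_labeling_def fV fE)
  then show ?thesis by blast
qed

end

theory Submission
  imports Defs
begin

text \<open>
  For the lower bound, a vertex of maximum degree \<open>\<Delta>\<close> and its incident edges carry
  \<open>\<Delta> + 1\<close> distinct positive labels. For the upper bound put \<open>K = \<Delta> + 3\<close> and label the central
  path periodically by \<open>1, K, 2, K - 1\<close> (by \<open>1, 4, 3\<close> if \<open>\<Delta> \<le> 2\<close>). Around each of these labels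
  at least \<open>\<Delta>\<close> pairwise compatible neighbour labels in \<open>{1..K}\<close> are available, among them the
  labels of the path neighbours, so the remaining neighbours, which are leaves, can be labeled
  injectively. A leaf imposes no condition beyond that on its single edge.
\<close>

section \<open>Edges, neighbours and degrees\<close>

context pair_graph
begin

lemma arcs_ends_eq_parcs: "arcs_ends (with_proj G) = parcs G"
  by (auto simp: arcs_ends_def arc_to_ends_def image_iff)

lemma edges_iff: "{u, v} \<in> edges G \<longleftrightarrow> (u, v) \<in> parcs G"
  unfolding edges_def by (auto simp: doubleton_eq_iff intro: arcs_symmetric)

lemma out_degree_eq_card: "out_degree (with_proj G) u = card {v. (u, v) \<in> parcs G}"
proof -
  have "out_arcs (with_proj G) u = Pair u ` {v. (u, v) \<in> parcs G}"
    by (auto simp: out_arcs_def)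
  then show ?thesis
    by (simp add: out_degree_def card_image inj_on_def)
qed

lemma finite_neighbours: "finite {v. (u, v) \<in> parcs G}"
  by (rule finite_subset[OF _ pair_finite_verts]) (auto dest: wellformed')

lemma finite_elements: "finite (elements G)"
proof -
  have "edges G = (\<lambda>(u, v). {u, v}) ` parcs G"
    by (auto simp: edges_def)
  then show ?thesis
    unfolding elements_def by simp
qed

lemma card_neighbours_le_max_degree:
  assumes "u \<in> pverts G"
  shows "card {v. (u, v) \<in> parcs G} \<le> max_degree G"
  unfolding max_degree_def out_degree_eq_card[symmetric]
  using assms by (intro Max_ge) auto

lemma max_degree_attained:
  assumes "pverts G \<noteq> {}"
  obtains u where "u \<in> pverts G" "card {v. (u, v) \<in> parcs G} = max_degree G"
proof -
  have "max_degree G \<in> out_degree (with_proj G) ` pverts G"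
    unfolding max_degree_def using assms by (intro Max_in) auto
  then show ?thesis
    using that by (auto simp: out_degree_eq_card)
qed

section \<open>The lower bound\<close>

lemma degree_less_label_bound:
  assumes f: "total_labeling G f" and u: "u \<in> pverts G"
    and le: "\<And>x. x \<in> elements G \<Longrightarrow> f x \<le> k"
  shows "card {v. (u, v) \<in> parcs G} < k"
proof -
  let ?N = "{v. (u, v) \<in> parcs G}"
  have N: "{u, v} \<in> edges G" "{v, u} \<in> edges G" if "v \<in> ?N" for v
    using that by (simp_all add: edges_iff arcs_symmetric)
  have f_edge: "f (Inr {a, b}) \<noteq> f (Inr {b, c})"
    if "{a, b} \<in> edges G" "{b, c} \<in> edges G" "{a, b} \<noteq> {b, c}" for a b c
    using f that unfolding total_labeling_def by simp
  have f_vertex: "f (Inl a) \<noteq> f (Inr {a, b})" if "{a, b} \<in> edges G" for a b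
    using f that unfolding total_labeling_def by simp
  have f_pos: "0 < f x" if "x \<in> elements G" for x
    using f that unfolding total_labeling_def by simp
  have "inj_on (\<lambda>v. f (Inr {u, v})) ?N"
  proof (rule inj_onI, rule ccontr)
    fix v w
    assume vw: "v \<in> ?N" "w \<in> ?N" "f (Inr {u, v}) = f (Inr {u, w})" "v \<noteq> w"
    \<comment> \<open>\<open>total_labeling\<close> puts the shared vertex in the middle, so the
      first edge is read as \<open>{v, u}\<close> and turned back afterwards.\<close>
    have "{v, u} \<noteq> {u, w}"
      using vw(4) by (auto simp: doubleton_eq_iff)
    then have "f (Inr {v, u}) \<noteq> f (Inr {u, w})"
      using f_edge N(2)[OF vw(1)] N(1)[OF vw(2)] by blast
    then show False
      using vw(3) by (simp add: insert_commute)
  qed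
  moreover have "f (Inl u) \<notin> (\<lambda>v. f (Inr {u, v})) ` ?N"
    using f_vertex N(1) by auto
  ultimately have "Suc (card ?N) = card (insert (f (Inl u)) ((\<lambda>v. f (Inr {u, v})) ` ?N))"
    by (simp add: card_image finite_neighbours)
  also have "\<dots> \<le> card {1..k}"
  proof (rule card_mono)
    have "f x \<in> {1..k}" if "x \<in> elements G" for x
      using f_pos[OF that] le[OF that] by simp
    moreover have "Inl u \<in> elements G" "v \<in> ?N \<Longrightarrow> Inr {u, v} \<in> elements G" for v
      using u N(1)[of v] by (auto simp: elements_def)
    ultimately show "insert (f (Inl u)) ((\<lambda>v. f (Inr {u, v})) ` ?N) \<subseteq> {1..k}"
      by blast
  qed simp
  finally show ?thesis
    by simp
qed

lemma max_degree_less_chi_td: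
  assumes "pverts G \<noteq> {}"
  shows "max_degree G < chi_td G"
proof -
  have "\<exists>f. k_total_difference_labeling G (chi_td G) f"
    unfolding chi_td_def by (rule LeastI_ex) (rule ex_total_difference_labeling, unfold_locales)
  then obtain f where "total_labeling G f" "Max (f ` elements G) = chi_td G"
    unfolding k_total_difference_labeling_def k_total_labeling_def by blast
  then show ?thesis
    using max_degree_attained[OF assms] degree_less_label_bound[of f _ "chi_td G"] finite_elements
    by (metis Max_ge finite_imageI imageI)
qed

section \<open>Reduction to vertex labels\<close>

text \<open>Edge labels are forced by vertex labels, so only conditions on \<open>g\<close> remain:
  for positive labels, the edge \<open>{u, v}\<close> repeats the label of \<open>u\<close> iff
  \<open>g v = 2 * g u\<close>, and edges \<open>{u, v}\<close>, \<open>{u, w}\<close> with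
  \<open>g v \<noteq> g w\<close> collide iff \<open>g v + g w = 2 * g u\<close>.\<close>

lemma chi_td_le:
  fixes g :: "'a \<Rightarrow> nat"
  assumes ne: "pverts G \<noteq> {}"
    and range: "\<And>v. v \<in> pverts G \<Longrightarrow> 0 < g v \<and> g v \<le> K"
    and adj: "\<And>u v. (u, v) \<in> parcs G \<Longrightarrow> g u \<noteq> g v \<and> g u \<noteq> 2 * g v"
    and cherry: "\<And>u v w. (u, v) \<in> parcs G \<Longrightarrow> (u, w) \<in> parcs G \<Longrightarrow> v \<noteq> w \<Longrightarrow>
      g v \<noteq> g w \<and> g v + g w \<noteq> 2 * g u"
  shows "chi_td G \<le> K"
proof -
  define f :: "'a + 'a set \<Rightarrow> nat" where
    "f x = (case x of Inl v \<Rightarrow> g v | Inr e \<Rightarrow> Max (g ` e) - Min (g ` e))" for x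
  have fV: "f (Inl v) = g v" for v
    by (simp add: f_def)
  have fE: "int (f (Inr {u, v})) = \<bar>int (g u) - int (g v)\<bar>" for u v
    by (auto simp: f_def max_def min_def)
  have vert: "u \<in> pverts G" "v \<in> pverts G" if "(u, v) \<in> parcs G" for u v
    using wellformed'[OF that] by auto
  have bound: "0 < f x \<and> f x \<le> K" if x: "x \<in> elements G" for x
  proof (cases x)
    case (Inl v)
    then show ?thesis
      using x range by (auto simp: elements_def fV)
  next
    case (Inr e)
    then obtain u v where e: "e = {u, v}" "(u, v) \<in> parcs G"
      using x by (auto simp: elements_def edges_def)
    then show ?thesis
      using fE[of u v] adj[OF e(2)] range[OF vert(1)[OF e(2)]] range[OF vert(2)[OF e(2)]] Inr
      by simp linarith
  qed
  have "f (Inr {u, v}) \<noteq> f (Inr {v, w})"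
    if uv: "(u, v) \<in> parcs G" and vw: "(v, w) \<in> parcs G" and ne: "{u, v} \<noteq> {v, w}" for u v w
  proof -
    have "u \<noteq> w"
      using ne by (auto simp: insert_commute)
    then show ?thesis
      using cherry[OF arcs_symmetric[OF uv] vw] fE[of u v] fE[of v w] by linarith
  qed
  moreover have "g u \<noteq> f (Inr {u, v})" if uv: "(u, v) \<in> parcs G" for u v
    using fE[of u v] adj[OF uv] adj[OF arcs_symmetric[OF uv]] range[OF vert(2)[OF uv]] by linarith
  ultimately have "total_labeling G f"
    using bound adj by (simp add: total_labeling_def edges_iff fV)
  then have "k_total_difference_labeling G (Max (f ` elements G)) f"
    by (simp add: k_total_difference_labeling_def k_total_labeling_def fV fE)
  \<comment> \<open>The largest label used may be below \<open>K\<close>; it still bounds the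
    minimum from above.\<close>
  then have "chi_td G \<le> Max (f ` elements G)"
    unfolding chi_td_def by (intro Least_le) blast
  also have "\<dots> \<le> K"
    using bound ne finite_elements by (subst Max_le_iff) (auto simp: elements_def)
  finally show ?thesis .
qed

section \<open>Structure of caterpillars\<close>

text \<open>The central path is a list of vertices, while \<open>cycle\<close> speaks of lists of
  arcs; this links the two.\<close>

lemma vwalk_imp_awalk:
  assumes "vwalk w (with_proj G)"
  shows "awalk (hd w) (vwalk_arcs w) (last w) \<and> awalk_verts (hd w) (vwalk_arcs w) = w"
  using assms
proof (induct w rule: vwalk_induct)
  case (Base u)
  then show ?case by (simp add: awalk_Nil_iff)
next
  case (Cons u v es)
  then show ?case by (simp add: awalk_Cons_iff arcs_ends_eq_parcs)
qed

text \<open>Appending the first vertex gives a walk that repeats only its start and has as many arcs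
  as \<open>w\<close> has vertices.\<close>

lemma closed_vpath_imp_cycle:
  assumes w: "vpath w (with_proj G)" and len: "3 \<le> length w" and closing: "(last w, hd w) \<in> parcs G"
  shows "\<exists>c. cycle c \<and> 3 \<le> length c"
proof -
  have ne: "w \<noteq> []"
    using len by auto
  have "vwalk (w @ [hd w]) (with_proj G)"
    using w ne closing wellformed'[OF closing]
    by (auto simp: vpath_def vwalk_def set_vwalk_arcs_snoc arcs_ends_eq_parcs)
  from vwalk_imp_awalk[OF this] have
    "awalk (hd w) (vwalk_arcs (w @ [hd w])) (hd w)"
    "awalk_verts (hd w) (vwalk_arcs (w @ [hd w])) = w @ [hd w]"
    using ne by auto
  moreover have "length (vwalk_arcs (w @ [hd w])) = length w"
    using vwalk_length_simp[of "w @ [hd w]"] unfolding vwalk_length_def by simp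
  moreover have "distinct (tl (w @ [hd w]))"
    using w ne by (cases w) (auto simp: vpath_def)
  ultimately show ?thesis
    using len unfolding cycle_def by (intro exI[of _ "vwalk_arcs (w @ [hd w])"]) auto
qed

lemma vpath_segment:
  assumes p: "vpath p (with_proj G)" and ij: "i \<le> j" "j < length p"
  obtains q where "vpath q (with_proj G)" "hd q = p ! i" "last q = p ! j"
    "length q = Suc (j - i)" "set q \<subseteq> set p"
proof
  define q where "q = take (Suc (j - i)) (drop i p)"
  have split: "p = take i p @ q @ drop (Suc (j - i)) (drop i p)"
    unfolding q_def by (metis append_take_drop_id)
  show len: "length q = Suc (j - i)"
    using ij by (simp add: q_def)
  then have ne: "q \<noteq> []"
    by auto
  have "vwalk (take i p @ q @ drop (Suc (j - i)) (drop i p)) (with_proj G)"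
    using p split by (simp add: vpath_def)
  then have "vwalk q (with_proj G)"
    using ne vwalkI_append_l vwalkI_append_r by (metis Nil_is_append_conv)
  then show "vpath q (with_proj G)"
    using p by (simp add: vpath_def q_def)
  show "hd q = p ! i" "last q = p ! j"
    using ij len ne by (simp_all add: hd_conv_nth last_conv_nth q_def)
  show "set q \<subseteq> set p"
    using split by (metis Un_iff set_append subsetI)
qed

lemma distance_le_1_imp:
  assumes "distance G u v \<le> 1"
  shows "u = v \<or> (u, v) \<in> parcs G"
proof -
  \<comment> \<open>\<open>\<mu>\<close> is an infimum over walks. A strict bound passes to some
    walk, whose cost is its number of arcs and hence at most one.\<close>
  have "\<mu> (\<lambda>_. 1) u v < 2"
    using assms unfolding distance_def by (rule le_less_trans) simp
  then obtain c where c: "awalk u c v" "ereal (awalk_cost (\<lambda>_. 1) c) < 2"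
    unfolding \<mu>_def by (auto simp: INF_less_iff)
  have "awalk_cost (\<lambda>_. 1) c = length c"
    by (induct c) auto
  then have "length c < 2"
    using c(2) by simp
  then consider "c = []" | e where "c = [e]"
    by (cases c) auto
  then show ?thesis
    using c(1) by cases (auto simp: awalk_Cons_iff awalk_Nil_iff)
qed

text \<open>An outside vertex has a neighbour on the path by the distance condition. The other
  claims about arcs hold because a failure would close a piece of the path to a cycle of length at
  least three: by a chord, by an outside vertex with two neighbours on the path, or by an outside
  edge whose ends both attach to the path.\<close>

lemma caterpillar_spine:
  assumes cat: "caterpillar G"
  obtains p where "p \<noteq> []" "distinct p" "set p \<subseteq> pverts G"
    "\<And>i j. i < j \<Longrightarrow> j < length p \<Longrightarrow> (p ! i, p ! j) \<in> parcs G \<Longrightarrow> j = Suc i"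
    "\<And>u v. (u, v) \<in> parcs G \<Longrightarrow> u \<in> set p \<or> v \<in> set p"
    "\<And>v. v \<in> pverts G \<Longrightarrow> v \<notin> set p \<Longrightarrow> \<exists>!u. (u, v) \<in> parcs G"
proof -
  obtain p where p: "vpath p (with_proj G)"
      and near: "\<And>v. v \<in> pverts G \<Longrightarrow> \<exists>u\<in>set p. distance G u v \<le> 1"
    using cat unfolding caterpillar_def by blast
  have acyclic: False if "vpath w (with_proj G)" "3 \<le> length w" "(last w, hd w) \<in> parcs G" for w
    using cat closed_vpath_imp_cycle[OF that] unfolding caterpillar_def undirected_tree_def by blast
  have parent: "\<exists>u\<in>set p. (u, v) \<in> parcs G" if "v \<in> pverts G" "v \<notin> set p" for v
    using near[OF that(1)] distance_le_1_imp that(2) by blast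
  \<comment> \<open>\<open>a\<close> and \<open>b\<close> may come in either order on the path, so
    the ends of \<open>q\<close> are given only as a set; for \<open>a = b\<close> the piece is a
    single vertex.\<close>
  have segment: "\<exists>q. vpath q (with_proj G) \<and> {hd q, last q} = {a, b} \<and> set q \<subseteq> set p \<and>
      q \<noteq> [] \<and> (a \<noteq> b \<longrightarrow> 2 \<le> length q)"
    if ab: "a \<in> set p" "b \<in> set p" for a b
  proof -
    obtain i j where ij: "i < length p" "p ! i = a" "j < length p" "p ! j = b"
      using ab unfolding in_set_conv_nth by blast
    then have "min i j \<le> max i j" "max i j < length p"
      by auto
    then obtain q where q: "vpath q (with_proj G)" "hd q = p ! min i j" "last q = p ! max i j"
        "length q = Suc (max i j - min i j)" "set q \<subseteq> set p"
      by (rule vpath_segment[OF p]) blast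
    have "{hd q, last q} = {a, b}"
      using q(2,3) ij by (cases "i \<le> j") (auto simp: min_def max_def)
    moreover have "q \<noteq> []" "a \<noteq> b \<longrightarrow> 2 \<le> length q"
      using q(4) ij by (cases i j rule: linorder_cases; auto)+
    ultimately show ?thesis
      using q(1,5) by blast
  qed
  have extend: "vpath (v # q) (with_proj G)"
    if "vpath q (with_proj G)" "(v, hd q) \<in> parcs G" "v \<notin> set q" for v q
    using that vwalk_wf_digraph_consI[of q v] by (auto simp: vpath_def arcs_ends_eq_parcs)
  have unique: "u = u'"
    if v: "v \<notin> set p" and u: "(u, v) \<in> parcs G" "u \<in> set p" and u': "(u', v) \<in> parcs G" "u' \<in> set p"
    for u u' v
  proof (rule ccontr)
    assume neq: "u \<noteq> u'"
    then obtain q where q: "vpath q (with_proj G)" "{hd q, last q} = {u, u'}" "set q \<subseteq> set p"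
        "q \<noteq> []" "2 \<le> length q"
      using segment[OF u(2) u'(2)] by blast
    have nb: "(hd q, v) \<in> parcs G" "(last q, v) \<in> parcs G"
      using q(2) u(1) u'(1) by (auto simp: doubleton_eq_iff)
    show False
      using acyclic[of "v # q"] extend[OF q(1) arcs_symmetric[OF nb(1)]] q(3-5) v nb(2) by auto
  qed
  show thesis
  proof (rule that)
    show "p \<noteq> []" "distinct p" "set p \<subseteq> pverts G"
      using p by (auto simp: vpath_def vwalk_def)
    show "j = Suc i" if ij: "i < j" "j < length p" "(p ! i, p ! j) \<in> parcs G" for i j
    proof (rule ccontr)
      assume "j \<noteq> Suc i"
      \<comment> \<open>This piece has at least three vertices unless \<open>j = Suc i\<close>, and
        the chord closes it.\<close>
      obtain q where "vpath q (with_proj G)" "hd q = p ! i" "last q = p ! j" "length q = Suc (j - i)"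
        by (rule vpath_segment[OF p less_imp_le[OF ij(1)] ij(2)]) blast
      then show False
        using acyclic[of q] ij(1) \<open>j \<noteq> Suc i\<close> arcs_symmetric[OF ij(3)] by simp linarith
    qed
    show spine_edge: "u \<in> set p \<or> v \<in> set p" if uv: "(u, v) \<in> parcs G" for u v
    proof (rule ccontr)
      assume out: "\<not> (u \<in> set p \<or> v \<in> set p)"
      have "u \<in> pverts G" "v \<in> pverts G" "u \<noteq> v"
        using wellformed'[OF uv] pair_no_loops[OF uv] by auto
      then obtain a b where ab: "a \<in> set p" "(a, u) \<in> parcs G" "b \<in> set p" "(b, v) \<in> parcs G"
        using parent out by meson
      \<comment> \<open>If \<open>a = b\<close>, then \<open>q\<close> is one vertex and
        \<open>y # x # q\<close> below is a triangle, so \<open>q \<noteq> []\<close> suffices for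
        length three.\<close>
      obtain q where q: "vpath q (with_proj G)" "{hd q, last q} = {a, b}" "set q \<subseteq> set p" "q \<noteq> []"
        using segment[OF ab(1,3)] by blast
      have "hd q = a \<and> last q = b \<or> hd q = b \<and> last q = a"
        using q(2) by (simp add: doubleton_eq_iff)
      \<comment> \<open>\<open>x\<close> and \<open>y\<close> are \<open>u\<close> and
        \<open>v\<close> in the order that fits the direction of \<open>q\<close>.\<close>
      then obtain x y where xy: "{x, y} = {u, v}" "(x, hd q) \<in> parcs G" "(last q, y) \<in> parcs G"
        using ab(2,4) arcs_symmetric[OF ab(2)] arcs_symmetric[OF ab(4)] by blast
      have notin: "x \<notin> set p" "y \<notin> set p" "x \<noteq> y" "(y, x) \<in> parcs G"
        using xy(1) out \<open>u \<noteq> v\<close> uv arcs_symmetric[OF uv] by (auto simp: doubleton_eq_iff)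
      have xq: "vpath (x # q) (with_proj G)"
        using extend[OF q(1) xy(2)] q(3) notin(1) by auto
      have "vpath (y # x # q) (with_proj G)"
        using extend[OF xq, of y] q(3) notin by auto
      moreover have "3 \<le> length (y # x # q)"
        using q(4) by (cases q) auto
      ultimately show False
        using acyclic[of "y # x # q"] q(4) xy(3) by simp
    qed
    show "\<exists>!u. (u, v) \<in> parcs G" if v: "v \<in> pverts G" "v \<notin> set p" for v
      using parent[OF v] unique[OF v(2)] spine_edge v(2) by metis
  qed
qed

end

section \<open>Supply of labels along the path\<close>

text \<open>Once \<open>c\<close> has used \<open>card B\<close> labels of \<open>A\<close>, at
  least \<open>card (N - B)\<close> are left. It serves for \<open>N\<close> the neighbours of a
  path vertex and \<open>B\<close> those on the path.\<close>

lemma inj_on_extend: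
  assumes fin: "finite N" "finite A" and card: "card N \<le> card A"
    and B: "B \<subseteq> N" "inj_on c B" "c ` B \<subseteq> A"
  obtains h where "inj_on h N" "h ` N \<subseteq> A" "\<And>x. x \<in> B \<Longrightarrow> h x = c x"
proof -
  have "finite B"
    using fin(1) B(1) by (rule rev_finite_subset)
  then have "card (N - B) \<le> card (A - c ` B)"
    using B card by (simp add: card_Diff_subset card_image)
  then obtain d where d: "d ` (N - B) \<subseteq> A - c ` B" "inj_on d (N - B)"
    using card_le_inj[of "N - B" "A - c ` B"] fin by auto
  define h where "h x = (if x \<in> B then c x else d x)" for x
  have "inj_on h N"
  proof (rule inj_onI)
    fix x y
    assume "x \<in> N" "y \<in> N" "h x = h y"
    then show "x = y"
      using d B(2) by (auto simp: h_def inj_on_def split: if_splits)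
  qed
  moreover have "h ` N \<subseteq> A"
    using d(1) B(3) by (auto simp: h_def)
  ultimately show thesis
    using that by (simp add: h_def)
qed

text \<open>
  The conditions on a set \<open>A\<close> of labels for the neighbours of a vertex labeled \<open>c\<close>: with positive
  labels, \<open>\<bar>a - c\<bar>\<close> equals \<open>c\<close> or \<open>a\<close> only if \<open>a = 2c\<close> or \<open>c = 2a\<close>, and \<open>\<bar>a - c\<bar> = \<bar>b - c\<bar>\<close>
  for \<open>a \<noteq> b\<close> only if \<open>a + b = 2c\<close>.
\<close>

definition admissible :: "nat \<Rightarrow> nat set \<Rightarrow> bool" where
  "admissible c A \<longleftrightarrow> (\<forall>a\<in>A. a \<noteq> c \<and> a \<noteq> 2 * c \<and> c \<noteq> 2 * a) \<and>
     (\<forall>a\<in>A. \<forall>b\<in>A. a \<noteq> b \<longrightarrow> a + b \<noteq> 2 * c)"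

text \<open>\<open>s i\<close> labels the \<open>i\<close>-th path vertex and \<open>A i\<close> is
  the supply for its neighbours; the last three conditions put the labels of its path neighbours
  into the supply and keep them distinct.\<close>

lemma spine_pattern:
  assumes "1 \<le> d"
  obtains s :: "nat \<Rightarrow> nat" and A :: "nat \<Rightarrow> nat set" where
    "\<And>i. s i \<in> {1..d + 3}"
    "\<And>i. A i \<subseteq> {1..d + 3}"
    "\<And>i. admissible (s i) (A i)"
    "\<And>i. d \<le> card (A i)"
    "\<And>i. s (Suc i) \<in> A i"
    "\<And>i. s i \<in> A (Suc i)"
    "\<And>i. s i \<noteq> s (Suc (Suc i))"
proof (cases "d \<le> 2")
  case True
  \<comment> \<open>The pattern of period four would put 4 next to 2 here, as \<open>K\<close> or as
    \<open>K - 1\<close>. Among 1, 3, 4 no label is twice another or the mean of the other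
    two.\<close>
  define s :: "nat \<Rightarrow> nat" where "s i = [1, 4, 3] ! (i mod 3)" for i
  define A :: "nat \<Rightarrow> nat set" where "A i = [{3, 4}, {1, 3}, {1, 4}] ! (i mod 3)" for i
  have "s i \<in> {1..d + 3} \<and> A i \<subseteq> {1..d + 3} \<and> admissible (s i) (A i) \<and> d \<le> card (A i) \<and>
      s (Suc i) \<in> A i \<and> s i \<in> A (Suc i) \<and> s i \<noteq> s (Suc (Suc i))" for i
  proof -
    consider "i mod 3 = 0" | "i mod 3 = 1" | "i mod 3 = 2"
      by linarith
    then show ?thesis
      using assms True by cases (simp_all add: s_def A_def admissible_def mod_Suc)
  qed
  then show thesis
    using that[of s A] by blast
next
  case False
  define K where "K = d + 3"
  have K: "6 \<le> K" "d = K - 3"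
    using False by (auto simp: K_def)
  define s :: "nat \<Rightarrow> nat" where "s i = [1, K, 2, K - 1] ! (i mod 4)" for i
  \<comment> \<open>The label \<open>c\<close> itself, its double and its half are left out. After
    that, a sum \<open>2 * c\<close> can arise only for \<open>c = K - 1\<close>, as
    \<open>K + (K - 2)\<close>, so \<open>K - 2\<close> is dropped there.\<close>
  define A :: "nat \<Rightarrow> nat set" where
    "A i = [{3..K}, {1..K - 1} - {K div 2}, {3..K} - {4}, insert K {a \<in> {1..K - 3}. 2 * a \<noteq> K - 1}]
      ! (i mod 4)" for i
  \<comment> \<open>The condition \<open>2 * a \<noteq> K - 1\<close> removes at most
    \<open>(K - 1) div 2\<close>, and the extra label \<open>K\<close> makes up for this
    loss.\<close>
  have "(K - 1) div 2 \<in> {1..K - 3}"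
    using K(1) by auto
  then have "K - 3 = Suc (card ({1..K - 3} - {(K - 1) div 2}))"
    using K(1) by (subst card_Diff_singleton) auto
  also have "\<dots> \<le> Suc (card {a \<in> {1..K - 3}. 2 * a \<noteq> K - 1})"
    by (auto intro!: card_mono)
  also have "\<dots> = card (insert K {a \<in> {1..K - 3}. 2 * a \<noteq> K - 1})"
    using K(1) by simp
  finally have card: "K - 3 \<le> card (insert K {a \<in> {1..K - 3}. 2 * a \<noteq> K - 1})" .
  have "s i \<in> {1..d + 3} \<and> A i \<subseteq> {1..d + 3} \<and> admissible (s i) (A i) \<and> d \<le> card (A i) \<and>
      s (Suc i) \<in> A i \<and> s i \<in> A (Suc i) \<and> s i \<noteq> s (Suc (Suc i))" for i
  proof -
    consider "i mod 4 = 0" | "i mod 4 = 1" | "i mod 4 = 2" | "i mod 4 = 3"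
      by linarith
    then show ?thesis
    proof cases
      case 1
      then show ?thesis
        using K by (auto simp: s_def A_def admissible_def mod_Suc)
    next
      case 2
      have "K div 2 \<in> {1..K - 1}"
        using K(1) by auto
      then have "K - 3 \<le> card ({1..K - 1} - {K div 2})"
        by (subst card_Diff_singleton) auto
      with 2 show ?thesis
        using K by (auto simp: s_def A_def admissible_def mod_Suc)
    next
      case 3
      then show ?thesis
        using K by (auto simp: s_def A_def admissible_def mod_Suc)
    next
      case 4
      then show ?thesis
        using K card by (auto simp: s_def A_def admissible_def mod_Suc)
    qed
  qed
  then show thesis
    using that[of s A] by blast
qed

section \<open>The upper bound\<close>

lemma (in pair_graph) caterpillar_chi_td_le:
  assumes cat: "caterpillar G"
  shows "chi_td G \<le> max_degree G + 3"
proof -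
  obtain p where p: "p \<noteq> []" "distinct p" "set p \<subseteq> pverts G"
    and chord: "\<And>i j. i < j \<Longrightarrow> j < length p \<Longrightarrow> (p ! i, p ! j) \<in> parcs G \<Longrightarrow> j = Suc i"
    and spine: "\<And>u v. (u, v) \<in> parcs G \<Longrightarrow> u \<in> set p \<or> v \<in> set p"
    and leaf: "\<And>v. v \<in> pverts G \<Longrightarrow> v \<notin> set p \<Longrightarrow> \<exists>!u. (u, v) \<in> parcs G"
    using caterpillar_spine[OF cat] by metis
  have ne: "pverts G \<noteq> {}"
    using p by auto
  let ?N = "\<lambda>u. {v. (u, v) \<in> parcs G}"
  have vert: "u \<in> pverts G" "v \<in> pverts G" if "(u, v) \<in> parcs G" for u v
    using wellformed'[OF that] by auto
  show ?thesis
  proof (cases "max_degree G = 0")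
    case True
    then have "parcs G = {}"
      using card_neighbours_le_max_degree finite_neighbours vert(1) by fastforce
    \<comment> \<open>\<open>spine_pattern\<close> starts at degree one; without arcs a constant
      labeling does.\<close>
    then show ?thesis
      using ne by (intro chi_td_le[where g = "\<lambda>_. 1"]) auto
  next
    case False
    then have pos: "1 \<le> max_degree G"
      by simp
    obtain s A where
      s: "\<And>i. s i \<in> {1..max_degree G + 3}" and A: "\<And>i. A i \<subseteq> {1..max_degree G + 3}"
      and adm: "\<And>i. admissible (s i) (A i)" and card: "\<And>i. max_degree G \<le> card (A i)"
      and s_Suc: "\<And>i. s (Suc i) \<in> A i" "\<And>i. s i \<in> A (Suc i)" and s_SucSuc: "\<And>i. s i \<noteq> s (Suc (Suc i))"
      by (rule spine_pattern[OF pos]) blast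
    define idx where "idx = the_inv_into {..<length p} ((!) p)"
    have idx: "idx (p ! i) = i" if "i < length p" for i
      unfolding idx_def using that p(2) by (intro the_inv_into_f_f) (auto simp: inj_on_nth)
    have idx_less: "idx u < length p" and nth_idx: "p ! idx u = u" if "u \<in> set p" for u
      using that idx by (auto simp: in_set_conv_nth)
    have idx_adj: "idx v = Suc (idx u) \<or> idx u = Suc (idx v)"
      if uv: "(u, v) \<in> parcs G" and "u \<in> set p" "v \<in> set p" for u v
    proof -
      have "idx u \<noteq> idx v"
        using nth_idx[OF that(2)] nth_idx[OF that(3)] pair_no_loops[OF uv] by auto
      then consider "idx u < idx v" | "idx v < idx u"
        by linarith
      then show ?thesis
      proof cases
        case 1
        then show ?thesis
          using chord[OF 1 idx_less[OF that(3)]] uv nth_idx[OF that(2)] nth_idx[OF that(3)] by simp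
      next
        case 2
        then show ?thesis
          using chord[OF 2 idx_less[OF that(2)]] arcs_symmetric[OF uv] nth_idx[OF that(2)]
            nth_idx[OF that(3)] by simp
      qed
    qed
    have "\<exists>h. inj_on h (?N u) \<and> h ` ?N u \<subseteq> A (idx u) \<and> (\<forall>v\<in>?N u \<inter> set p. h v = s (idx v))"
      if u: "u \<in> set p" for u
    proof (rule inj_on_extend[of "?N u" "A (idx u)" "?N u \<inter> set p" "\<lambda>v. s (idx v)"])
      show "finite (?N u)"
        by (rule finite_neighbours)
      show "finite (A (idx u))"
        using A by (rule finite_subset) simp
      show "card (?N u) \<le> card (A (idx u))"
        using card_neighbours_le_max_degree card u p(3) by (meson order_trans subsetD)
      show "inj_on (\<lambda>v. s (idx v)) (?N u \<inter> set p)"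
      proof (rule inj_onI)
        fix v w
        assume vw: "v \<in> ?N u \<inter> set p" "w \<in> ?N u \<inter> set p" "s (idx v) = s (idx w)"
        \<comment> \<open>Distinct positions next to \<open>idx u\<close> differ by two, where
          \<open>s\<close> takes different values.\<close>
        then have "idx v = idx w"
          using idx_adj[of u v] idx_adj[of u w] u s_SucSuc[of "idx v"] s_SucSuc[of "idx w"] by auto
        then show "v = w"
          using nth_idx vw by (metis IntD2)
      qed
      show "(\<lambda>v. s (idx v)) ` (?N u \<inter> set p) \<subseteq> A (idx u)"
      proof (rule image_subsetI)
        fix v
        assume "v \<in> ?N u \<inter> set p"
        then show "s (idx v) \<in> A (idx u)"
          using idx_adj[of u v] u s_Suc[of "idx u"] s_Suc[of "idx v"] by auto
      qed
    qed auto
    then obtain h where h: "\<And>u. u \<in> set p \<Longrightarrow> inj_on (h u) (?N u)"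
        "\<And>u. u \<in> set p \<Longrightarrow> h u ` ?N u \<subseteq> A (idx u)"
        "\<And>u v. u \<in> set p \<Longrightarrow> v \<in> ?N u \<inter> set p \<Longrightarrow> h u v = s (idx v)"
      by metis
    \<comment> \<open>The maps \<open>h u\<close> agree with \<open>s\<close> on the path, and a
      vertex off the path has just one neighbour, so the local labelings glue together.\<close>
    define g where "g v = (if v \<in> set p then s (idx v) else h (THE u. (u, v) \<in> parcs G) v)" for v
    have g_spine: "g u = s (idx u)" if "u \<in> set p" for u
      using that by (simp add: g_def)
    have g_nb: "g v = h u v" if u: "u \<in> set p" and uv: "(u, v) \<in> parcs G" for u v
    proof (cases "v \<in> set p")
      case True
      then show ?thesis
        using h(3)[OF u, of v] uv by (simp add: g_spine)
    next
      case False
      then have "(THE u. (u, v) \<in> parcs G) = u"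
        using leaf[OF vert(2)[OF uv]] uv by (intro the1_equality) auto
      then show ?thesis
        using False by (simp add: g_def)
    qed
    have g_A: "g v \<in> A (idx u)" if "u \<in> set p" "(u, v) \<in> parcs G" for u v
      using h(2)[OF that(1)] g_nb[OF that] that(2) by auto
    show ?thesis
    proof (rule chi_td_le[OF ne])
      fix v
      assume v: "v \<in> pverts G"
      have "g v \<in> {1..max_degree G + 3}"
      proof (cases "v \<in> set p")
        case True
        then show ?thesis
          using s g_spine by metis
      next
        case False
        then obtain u where uv: "(u, v) \<in> parcs G"
          using leaf[OF v] by auto
        then have "u \<in> set p"
          using spine False by blast
        then show ?thesis
          using g_A[OF _ uv] A by blast
      qed
      then show "0 < g v \<and> g v \<le> max_degree G + 3"
        by auto
    next
      fix u v
      assume uv: "(u, v) \<in> parcs G"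
      \<comment> \<open>The claim is symmetric in the two labels, so it serves whichever end of the
        arc lies on the path.\<close>
      have "g a \<noteq> g b \<and> g a \<noteq> 2 * g b \<and> g b \<noteq> 2 * g a" if "a \<in> set p" "(a, b) \<in> parcs G" for a b
        using adm[of "idx a"] g_A[OF that] g_spine[OF that(1)] unfolding admissible_def by metis
      then show "g u \<noteq> g v \<and> g u \<noteq> 2 * g v"
        using spine[OF uv] uv arcs_symmetric[OF uv] by metis
    next
      fix u v w
      assume uv: "(u, v) \<in> parcs G" and uw: "(u, w) \<in> parcs G" and "v \<noteq> w"
      \<comment> \<open>A vertex off the path has one neighbour and cannot be the centre of a
        cherry.\<close>
      have u: "u \<in> set p"
      proof (rule ccontr)
        assume "u \<notin> set p"
        then show False
          using leaf[OF vert(1)[OF uv]] arcs_symmetric[OF uv] arcs_symmetric[OF uw] \<open>v \<noteq> w\<close> by blast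
      qed
      have "g v \<noteq> g w"
        using h(1)[OF u] g_nb[OF u] uv uw \<open>v \<noteq> w\<close> by (auto dest: inj_onD)
      then show "g v \<noteq> g w \<and> g v + g w \<noteq> 2 * g u"
        using adm[of "idx u"] g_A[OF u uv] g_A[OF u uw] g_spine[OF u] unfolding admissible_def by metis
    qed
  qed
qed

theorem theorem6p3:
  fixes G :: "'a pair_pre_digraph"
  assumes "pair_graph G"
    and "caterpillar G"
  shows "max_degree G + 1 \<le> chi_td G \<and> chi_td G \<le> max_degree G + 3"
proof -
  interpret pair_graph G by fact
  \<comment> \<open>The nonempty central path supplies the nonempty vertex set that the lower bound
    assumes.\<close>
  obtain p where "p \<noteq> []" "set p \<subseteq> pverts G"
    using caterpillar_spine[OF assms(2)] by metis
  then show ?thesis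
    using max_degree_less_chi_td caterpillar_chi_td_le[OF assms(2)] by force
qed

end
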